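(* Let $u$ be an eigenfunction of $-\Delta$ on $K$ with eigenvalue $\lambda$. Then there exists $m_0\ge 1$ such that $u|_{K_m}$ is an eigenfunction of $-\Delta_m$ for every $m\ge m_0$. Writing $\lambda_m$ for the eigenvalue of $u|_{K_m}$ (for $m\ge m_0$), this $m_0$ can be taken so that the following hold: (i) $\lambda=\lim_{m\to\infty}15^m\lambda_m$; (ii) for every $m\ge m_0$ there is $i=i(m)\in\{1,2,3\}$ with $\lambda_{m+1}=\varphi_i(\lambda_m)$, and only $i=1$ or $i=3$ is allowed (i.e. occurs) if $\lambda_m=0$; (iii) there exists $m_1$ such that $i(m)=1$ for all $m\ge m_1$; (iv) $\lambda_{m_0}\in\{0,1,3,5\}$ if $m_0=1$, and $\lambda_{m_0}\in\{1,3\}$ if $m_0>1$.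
   Context: Identify the circle with $\mathbb{R}/\mathbb{Z}$ (so $0=1$). For $m\ge 0$ consider the $2\cdot 5^m$ points $\frac{n}{2\cdot 5^m}$, $1\le n\le 2\cdot 5^m$. Each such $n$ is uniquely $n=5^k(a+5j)$ with $k,j\ge 0$ integers and $a\in\{1,2,3,4\}$. Identify these points in pairs by $$\frac{5^k(1+5j)}{2\cdot 5^m}\sim\frac{5^k(2+5j)}{2\cdot 5^m},\qquad \frac{5^k(3+5j)}{2\cdot 5^m}\sim\frac{5^k(4+5j)}{2\cdot 5^m}$$ (for example $\frac12\sim 1$). These identifications are consistent for different $m$. The graph $K_m$ has as vertices the $5^m$ identified pairs, and as edges the arcs joining consecutive points of the form $\frac{n}{2\cdot5^m}$ on the circle (loops may occur). Functions on $K_m$ are real functions $u$ on these points with $u(x)=u(y)$ whenever $x\sim y$. For a vertex $x\sim y$ let $N_m(x)$ be the list (with multiplicity) of the four points $x\pm\frac{1}{2\cdot5^m}$, $y\pm\frac1{2\cdot5^m}$. The Laplacian on $K_m$ is $$-\Delta_m u(x)=\sum_{z\in N_m(x)}(u(x)-u(z)).$$ $K$ (the Vicsek set with no loose ends) is the circle $\mathbb{R}/\mathbb{Z}$ with the identifications $\frac{5^k(1+5j)}{2\cdot 5^m}\sim\frac{5^k(2+5j)}{2\cdot 5^m}$ and $\frac{5^k(3+5j)}{2\cdot 5^m}\sim\frac{5^k(4+5j)}{2\cdot 5^m}$ (integers $k,j\ge0$, numerators between $1$ and $2\cdot5^m$) made for all $m\ge0$; a continuous function on $K$ is a continuous function $u:\mathbb{R}/\mathbb{Z}\to\mathbb{R}$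 with $u(x)=u(y)$ for all identified pairs $x\sim y$ of all levels. Its restriction to the vertices of $K_m$ is denoted $u|_{K_m}$. A continuous function $u$ on $K$ belongs to $\operatorname{dom}\Delta$ with $\Delta u=f$, where $f$ is a continuous function on $K$, if $15^m\Delta_m (u|_{K_m})\to f$ uniformly, i.e. $\sup_{x\in K_m}|15^m\Delta_m (u|_{K_m})(x)-f(x)|\to0$ as $m\to\infty$ (the supremum being over vertices $x$ of $K_m$). An eigenfunction of $-\Delta$ with eigenvalue $\lambda$ is a nonzero $u\in\operatorname{dom}\Delta$ with $-\Delta u=\lambda u$. Let $R(x)=x(3-x)(5-x)$. For $y\in[0,4+\sqrt2]$ the equation $R(x)=y$ has three distinct real solutions, denoted $\varphi_1(y)<\varphi_2(y)<\varphi_3(y)$. All eigenvalues of $-\Delta_m$ lie in $[0,4+\sqrt2]$. *)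

theory Defs
  imports Complex_Main
begin

text \<open>
  Functions on the circle \<open>\<real>/\<int>\<close> are represented by 1-periodic functions on the reals, so that
  \<open>pt m n\<close> with arbitrary integer \<open>n\<close> stands for a point of level \<open>m\<close> on the circle.
\<close>

definition pt :: "nat \<Rightarrow> int \<Rightarrow> real" where
  "pt m n = of_int n / (2 * 5 ^ m)"

text \<open>
  A vertex of \<open>K\<^sub>m\<close> is the pair \<open>(x, y)\<close> of its two identified points, the numerators being
  \<open>5\<^sup>k (a + 5 j)\<close> and \<open>5\<^sup>k (a + 1 + 5 j)\<close> with \<open>a = 1\<close> or \<open>a = 3\<close>.  Only this order of the two
  points is used, so each vertex is listed exactly once.
\<close>

definition vertices :: "nat \<Rightarrow> (real \<times> real) set" where
  "vertices m =
     {(pt m (5 ^ k * (a + 5 * int j)), pt m (5 ^ k * (a + 1 + 5 * int j))) | (k::nat) (j::nat) (a::int).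
        a \<in> {1, 3} \<and>
        5 ^ k * (a + 5 * int j) \<in> {1..2 * 5 ^ m} \<and>
        5 ^ k * (a + 1 + 5 * int j) \<in> {1..2 * 5 ^ m}}"

text \<open>
  The notions for \<open>K\<^sub>m\<close> below only involve the values of \<open>v\<close> at the points \<open>pt m n\<close>; applied to
  a function \<open>u\<close> on the whole circle they therefore speak about the restriction of \<open>u\<close> to \<open>K\<^sub>m\<close>.
\<close>

definition graph_function :: "nat \<Rightarrow> (real \<Rightarrow> real) \<Rightarrow> bool" where
  "graph_function m v \<longleftrightarrow>
     (\<forall>n. v (pt m n + 1) = v (pt m n)) \<and> (\<forall>(x, y)\<in>vertices m. v x = v y)"

definition neighbours :: "nat \<Rightarrow> real \<times> real \<Rightarrow> real list" where
  "neighbours m = (\<lambda>(x, y). let h = 1 / (2 * 5 ^ m) in [x + h, x - h, y + h, y - h])"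

definition graph_laplacian :: "nat \<Rightarrow> (real \<Rightarrow> real) \<Rightarrow> real \<times> real \<Rightarrow> real" where
  "graph_laplacian m v p = - (\<Sum>z\<leftarrow>neighbours m p. v (fst p) - v z)"

definition graph_eigenfunction :: "nat \<Rightarrow> (real \<Rightarrow> real) \<Rightarrow> real \<Rightarrow> bool" where
  "graph_eigenfunction m v \<mu> \<longleftrightarrow>
     graph_function m v \<and> (\<exists>n. v (pt m n) \<noteq> 0) \<and>
     (\<forall>p\<in>vertices m. - graph_laplacian m v p = \<mu> * v (fst p))"

definition vicsek_continuous :: "(real \<Rightarrow> real) \<Rightarrow> bool" where
  "vicsek_continuous u \<longleftrightarrow>
     continuous_on UNIV u \<and> (\<forall>x. u (x + 1) = u x) \<and> (\<forall>m. \<forall>(x, y)\<in>vertices m. u x = u y)"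

text \<open>\<open>has_laplacian u f\<close>: \<open>u\<close> is in the domain of the Laplacian on \<open>K\<close>, with \<open>\<Delta> u = f\<close>.\<close>

definition has_laplacian :: "(real \<Rightarrow> real) \<Rightarrow> (real \<Rightarrow> real) \<Rightarrow> bool" where
  "has_laplacian u f \<longleftrightarrow>
     vicsek_continuous u \<and> vicsek_continuous f \<and>
     (\<lambda>m. SUP p\<in>vertices m. \<bar>15 ^ m * graph_laplacian m u p - f (fst p)\<bar>) \<longlonglongrightarrow> 0"

definition vicsek_eigenfunction :: "(real \<Rightarrow> real) \<Rightarrow> real \<Rightarrow> bool" where
  "vicsek_eigenfunction u lam \<longleftrightarrow>
     (\<exists>x. u x \<noteq> 0) \<and> (\<exists>f. has_laplacian u f \<and> (\<forall>x. - f x = lam * u x))"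

definition R :: "real \<Rightarrow> real" where
  "R x = x * (3 - x) * (5 - x)"

text \<open>
  \<open>\<phi> i y\<close> for \<open>i \<in> {1, 2, 3}\<close> is the \<open>i\<close>-th smallest real solution of \<open>R x = y\<close> (list positions
  start at 0).  It is meant for \<open>y\<close> in \<open>[0, 4 + sqrt 2]\<close>, where there are three solutions.
\<close>

definition \<phi> :: "nat \<Rightarrow> real \<Rightarrow> real" where
  "\<phi> i y = sorted_list_of_set {x. R x = y} ! (i - 1)"

end

theory Submission
  imports Defs
begin

text \<open>
  Passing from \<open>K\<^sub>m\<close> to \<open>K\<^bsub>m+1\<^esub>\<close> replaces every edge from \<open>x\<close> to \<open>y\<close> by a path \<open>x, A, B, y\<close> whose two new
  vertices \<open>A\<close> and \<open>B\<close> carry a loop.  Loops do not contribute to the Laplacian, so the eigenvalue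
  equations at \<open>A\<close> and \<open>B\<close> are \<open>(2 - \<mu>) A = x + B\<close> and \<open>(2 - \<mu>) B = A + y\<close>.  Solving them for \<open>A\<close> and \<open>B\<close>
  on the four edges at an old vertex and substituting into the equation there produces the
  equation of level \<open>m\<close> with \<open>R \<mu>\<close> in place of \<open>\<mu>\<close>.

  The identity \<open>residual_decimation\<close> keeps track of the defects of all the equations: the defect at
  an old vertex for \<open>R \<mu>\<close> is \<open>(1 - \<mu>) (3 - \<mu>)\<close> times its defect for \<open>\<mu>\<close>, plus four times \<open>2 - \<mu>\<close> and four
  times \<open>1\<close> times defects at new vertices.  It is used twice.

  With all defects zero it says that an eigenfunction for \<open>\<mu>\<close> on \<open>K\<^bsub>m+1\<^esub>\<close> satisfies the equation for \<open>R \<mu>\<close>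
  on \<open>K\<^sub>m\<close>; moreover its restriction can only vanish if \<open>\<mu>\<close> is \<open>1\<close> or \<open>3\<close>.

  With approximate equations it shows that every eigenfunction \<open>u\<close> of the fractal is an exact
  eigenfunction on all fine enough graphs.  On \<open>K\<^sub>n\<close> the function \<open>u\<close> satisfies the equation for
  \<open>lam / 15\<^sup>n\<close> with a defect of at most \<open>\<epsilon>\<^sub>n / 15\<^sup>n\<close>, where \<open>\<epsilon>\<^sub>n \<rightarrow> 0\<close>.  For \<open>0 \<le> \<mu> \<le> 1\<close> the coefficients above
  add up to \<open>(3 - \<mu>) (5 - \<mu>) \<le> 15\<close>, so each of the \<open>n - m\<close> steps down to a fixed level \<open>m\<close> costs at most
  the factor \<open>15\<close>, and on \<open>K\<^sub>m\<close> there remains a defect of at most \<open>\<epsilon>\<^sub>n / 15\<^sup>m\<close> for the number \<open>\<mu>\<^sub>n\<close> obtained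
  from \<open>lam / 15\<^sup>n\<close> by \<open>n - m\<close> applications of \<open>R\<close>.  As \<open>n \<rightarrow> \<infinity>\<close> the defect disappears, and at a vertex where
  \<open>u\<close> is nonzero this forces \<open>\<mu>\<^sub>n\<close> to converge; the limit is an eigenvalue of \<open>u\<close> on \<open>K\<^sub>m\<close>
  (\<open>restriction_is_graph_eigenfunction\<close>).  The iteration stays in \<open>[0, 1]\<close> as soon as \<open>lam \<le> 15\<^sup>m\<close>, because
  \<open>0 \<le> R \<mu> \<le> 15 \<mu>\<close> there; that \<open>lam\<close> is nonnegative is a maximum principle.

  Now let \<open>m\<^sub>0 \<ge> 1\<close> be the least level from which on \<open>u\<close> is a graph eigenfunction.  If the eigenvalue at
  \<open>m\<^sub>0\<close> is neither \<open>1\<close> nor \<open>3\<close>, then \<open>u\<close> is an eigenfunction on level \<open>m\<^sub>0 - 1\<close> as well, so \<open>m\<^sub>0 = 1\<close>, and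
  since \<open>0\<close> is the only eigenvalue of \<open>K\<^sub>0\<close> the eigenvalue at \<open>m\<^sub>0\<close> is a root of \<open>R\<close>.  Consecutive
  eigenvalues are related by \<open>R\<close>, hence by one of the three inverse branches, because all of them lie
  in \<open>[0, 8]\<close> and \<open>R x = y\<close> has three solutions for every \<open>y\<close> in this interval.  The second branch is excluded at \<open>0\<close> because
  an eigenfunction with eigenvalue \<open>3\<close> vanishes on the previous level.  Finally \<open>15\<^sup>m \<lambda>\<^sub>m \<rightarrow> lam\<close> gives
  \<open>\<lambda>\<^sub>m \<rightarrow> 0\<close>, and a root of \<open>R x = y\<close> below \<open>1\<close> is the smallest one.
\<close>

section \<open>Points and vertices of consecutive levels\<close>

lemma pt_Suc_5 [simp]: "pt (Suc m) (5 * n) = pt m n"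
  by (simp add: pt_def)

lemma pt_add_period: "pt m (n + 2 * 5 ^ m) = pt m n + 1"
  by (simp add: pt_def field_simps)

lemma pt_mono_level:
  assumes "m \<le> k"
  shows "\<exists>i. pt k i = pt m n"
  using assms
proof (induction rule: dec_induct)
  case (step k)
  then show ?case by (metis pt_Suc_5)
qed blast

lemma vertices_Suc: "vertices m \<subseteq> vertices (Suc m)"
proof
  fix p assume "p \<in> vertices m"
  then obtain k j :: nat and a :: int where p:
      "p = (pt m (5 ^ k * (a + 5 * int j)), pt m (5 ^ k * (a + 1 + 5 * int j)))" and a: "a \<in> {1, 3}"
    and r: "5 ^ k * (a + 5 * int j) \<in> {1..2 * 5 ^ m}" "5 ^ k * (a + 1 + 5 * int j) \<in> {1..2 * 5 ^ m}"
    unfolding vertices_def by blast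
  have e: "5 ^ Suc k * x = 5 * (5 ^ k * x)" for x :: int by simp
  have "p = (pt (Suc m) (5 ^ Suc k * (a + 5 * int j)), pt (Suc m) (5 ^ Suc k * (a + 1 + 5 * int j)))"
    unfolding e pt_Suc_5 by (rule p)
  moreover have "5 ^ Suc k * (a + 5 * int j) \<in> {1..2 * 5 ^ Suc m}"
      "5 ^ Suc k * (a + 1 + 5 * int j) \<in> {1..2 * 5 ^ Suc m}"
    using r unfolding e by auto
  ultimately show "p \<in> vertices (Suc m)"
    unfolding vertices_def using a by blast
qed

lemma vertices_mono: "m \<le> n \<Longrightarrow> vertices m \<subseteq> vertices n"
  by (rule lift_Suc_mono_le[of vertices, OF vertices_Suc])

text \<open>
  Dividing the edge from \<open>j\<close> to \<open>j + 1\<close> of level \<open>m\<close> into five parts creates two new vertices, called \<open>A\<close>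
  and \<open>B\<close> below: \<open>A\<close> consists of \<open>5 j + 1\<close> and \<open>5 j + 2\<close>, and \<open>B\<close> of \<open>5 j + 3\<close> and \<open>5 j + 4\<close>.
\<close>

lemma new_vertex:
  assumes j: "0 \<le> j" "j < 2 * 5 ^ m" and ab: "(a, b) \<in> {(1, 2), (3, 4)}"
  shows "(pt (Suc m) (5 * j + a), pt (Suc m) (5 * j + b)) \<in> vertices (Suc m)"
proof -
  have e: "5 * j + a = 5 ^ 0 * (a + 5 * int (nat j))" "5 * j + b = 5 ^ 0 * (a + 1 + 5 * int (nat j))"
    using assms by auto
  have "5 * j + a \<in> {1..2 * 5 ^ Suc m}" "5 * j + b \<in> {1..2 * 5 ^ Suc m}" "a \<in> {1, 3}"
    using assms by auto
  then show ?thesis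
    unfolding vertices_def e by blast
qed

lemma vertexE:
  assumes "p \<in> vertices m"
  obtains a b where "p = (pt m a, pt m b)" "a \<in> {1..2 * 5 ^ m}" "b \<in> {1..2 * 5 ^ m}"
  using assms unfolding vertices_def by blast

lemma finite_vertices: "finite (vertices m)"
proof (rule finite_subset)
  show "vertices m \<subseteq> (\<lambda>(a, b). (pt m a, pt m b)) ` ({1..2 * 5 ^ m} \<times> {1..2 * 5 ^ m})"
    by (auto elim!: vertexE)
qed auto

lemma vertex_0: "(pt 0 1, pt 0 2) \<in> vertices 0"
  unfolding vertices_def mem_Collect_eq by (intro exI[of _ 0] exI[of _ 1]) auto

lemma int_mod_5_cases:
  obtains j r :: int where "n = 5 * j + r" "r \<in> {0, 1, 2, 3, 4}"
proof
  show "n = 5 * (n div 5) + n mod 5" by simp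
  show "n mod 5 \<in> {0, 1, 2, 3, 4}" by auto
qed

lemma vertices_cover:
  "n \<in> {1..2 * 5 ^ m} \<Longrightarrow> \<exists>p\<in>vertices m. pt m n = fst p \<or> pt m n = snd p"
proof (induction m arbitrary: n)
  case 0
  then have "n = 1 \<or> n = 2" by auto
  then show ?case using vertex_0 by force
next
  case (Suc m)
  obtain j r where n: "n = 5 * j + r" and r: "r \<in> {0, 1, 2, 3, 4}" by (rule int_mod_5_cases)
  show ?case
  proof (cases "r = 0")
    case True
    then have "j \<in> {1..2 * 5 ^ m}" using Suc.prems n by auto
    from Suc.IH[OF this] show ?thesis using True n vertices_Suc[of m] by auto
  next
    case False
    then have j: "0 \<le> j" "j < 2 * 5 ^ m" using Suc.prems n r by auto
    have "(1, 2) \<in> {(1, 2), (3, 4 :: int)}" "(3, 4) \<in> {(1, 2), (3, 4 :: int)}" by auto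
    note new = this[THEN new_vertex[OF j]]
    have "r \<in> {1, 2} \<or> r \<in> {3, 4}" using False r by auto
    then show ?thesis
      using bexI[OF _ new(1)] bexI[OF _ new(2)] n by auto
  qed
qed

text \<open>
  The vertices partition the points of the circle into pairs.  By induction on the level: the
  points that are not multiples of \<open>5\<close> cancel within the new vertices, and the multiples of \<open>5\<close> are the
  points of the previous level.
\<close>

lemma sum_over_vertices_eq_0:
  fixes g :: "real \<Rightarrow> real"
  shows "(\<And>p. p \<in> vertices m \<Longrightarrow> g (fst p) + g (snd p) = 0) \<Longrightarrow> (\<Sum>n\<in>{1..2 * 5 ^ m}. g (pt m n)) = 0"
proof (induction m)
  case 0
  have "{1..2 * 5 ^ 0} = {1, 2 :: int}" by auto
  then show ?case using 0[OF vertex_0] by simp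
next
  case (Suc m)
  have block: "(\<Sum>n\<in>{1..5 * int M}. f n) =
      (\<Sum>j\<in>{0..<int M}. f (5*j+1) + f (5*j+2) + f (5*j+3) + f (5*j+4)) + (\<Sum>j\<in>{1..int M}. f (5*j))"
    for M :: nat and f :: "int \<Rightarrow> real"
  proof (induction M)
    case (Suc M)
    have "{1..5 * int (Suc M)} =
        {1..5 * int M} \<union> {5 * int M + 1, 5 * int M + 2, 5 * int M + 3, 5 * int M + 4, 5 * (int M + 1)}"
      by auto
    moreover have "{0..<int (Suc M)} = insert (int M) {0..<int M}"
        "{1..int (Suc M)} = insert (int M + 1) {1..int M}"
      by auto
    ultimately show ?case
      using Suc by (subst sum.union_disjoint | simp)+
  qed simp
  have "(\<Sum>n\<in>{1..2 * 5 ^ Suc m}. g (pt (Suc m) n)) =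
      (\<Sum>j\<in>{0..<2 * 5 ^ m}. g (pt (Suc m) (5*j+1)) + g (pt (Suc m) (5*j+2))
         + g (pt (Suc m) (5*j+3)) + g (pt (Suc m) (5*j+4))) + (\<Sum>j\<in>{1..2 * 5 ^ m}. g (pt m j))"
    using block[of "\<lambda>n. g (pt (Suc m) n)" "2 * 5 ^ m"] by simp
  also have "(\<Sum>j\<in>{0..<2 * 5 ^ m}. g (pt (Suc m) (5*j+1)) + g (pt (Suc m) (5*j+2))
         + g (pt (Suc m) (5*j+3)) + g (pt (Suc m) (5*j+4))) = 0"
  proof (rule sum.neutral, rule ballI)
    fix j :: int assume "j \<in> {0..<2 * 5 ^ m}"
    then have j: "0 \<le> j" "j < 2 * 5 ^ m" by auto
    show "g (pt (Suc m) (5*j+1)) + g (pt (Suc m) (5*j+2))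
         + g (pt (Suc m) (5*j+3)) + g (pt (Suc m) (5*j+4)) = 0"
      using Suc.prems[OF new_vertex[OF j, of 1 2]] Suc.prems[OF new_vertex[OF j, of 3 4]] by simp
  qed
  also have "(\<Sum>j\<in>{1..2 * 5 ^ m}. g (pt m j)) = 0"
    using Suc.prems vertices_Suc[of m] by (intro Suc.IH) auto
  finally show ?case by simp
qed

section \<open>Functions on the graphs\<close>

text \<open>
  The vertices are listed with numerators in one period only; this transfers statements about them
  to arbitrary integer numerators, so that no edge needs special treatment for crossing \<open>0 = 1\<close>.
\<close>

lemma all_int_of_period:
  fixes N :: int
  assumes "0 < N" and shift: "\<And>n. Q (n + N) \<longleftrightarrow> Q n" and "\<And>n. 0 \<le> n \<Longrightarrow> n < N \<Longrightarrow> Q n"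
  shows "Q n"
proof -
  have step: "Q (n + int k * N) \<longleftrightarrow> Q n" for n k
  proof (induction k)
    case (Suc k)
    then show ?case using shift[of "n + int k * N"] by (simp add: algebra_simps)
  qed simp
  have "Q (n + i * N) \<longleftrightarrow> Q n" for n i
  proof (cases "0 \<le> i")
    case True
    then show ?thesis using step[of n "nat i"] by simp
  next
    case False
    then show ?thesis using step[of "n + i * N" "nat (- i)"] by simp
  qed
  from this[of "n mod N" "n div N"] have "Q n \<longleftrightarrow> Q (n mod N)" by simp
  with assms show ?thesis by simp
qed

lemma graph_function_period:
  "graph_function m v \<Longrightarrow> v (pt m (n + 2 * 5 ^ m)) = v (pt m n)"
  by (simp add: graph_function_def pt_add_period)

lemma graph_function_vertex:
  "graph_function m v \<Longrightarrow> (x, y) \<in> vertices m \<Longrightarrow> v x = v y"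
  by (auto simp: graph_function_def)

lemma graph_function_SucD: "graph_function (Suc m) v \<Longrightarrow> graph_function m v"
  unfolding graph_function_def using vertices_Suc[of m] pt_Suc_5[of m] by (metis subset_iff)

lemma graph_function_new_vertex:
  assumes v: "graph_function (Suc m) v" and ab: "(a, b) \<in> {(1, 2), (3, 4)}"
  shows "v (pt (Suc m) (5 * j + a)) = v (pt (Suc m) (5 * j + b))"
proof (rule all_int_of_period[where N = "2 * 5 ^ m" and n = j
      and Q = "\<lambda>j. v (pt (Suc m) (5 * j + a)) = v (pt (Suc m) (5 * j + b))"])
  fix n :: int
  show "v (pt (Suc m) (5 * (n + 2 * 5 ^ m) + a)) = v (pt (Suc m) (5 * (n + 2 * 5 ^ m) + b)) \<longleftrightarrow>
        v (pt (Suc m) (5 * n + a)) = v (pt (Suc m) (5 * n + b))"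
    using graph_function_period[OF v, of "5 * n + a"] graph_function_period[OF v, of "5 * n + b"]
    by (simp add: algebra_simps)
  show "v (pt (Suc m) (5 * n + a)) = v (pt (Suc m) (5 * n + b))" if "0 \<le> n" "n < 2 * 5 ^ m"
    using graph_function_vertex[OF v] new_vertex[OF that ab] by blast
qed simp

lemma graph_function_value_at_vertex:
  assumes v: "graph_function m v"
  shows "\<exists>p\<in>vertices m. v (pt m n) = v (fst p)"
proof (rule all_int_of_period[where N = "2 * 5 ^ m" and n = n
      and Q = "\<lambda>n. \<exists>p\<in>vertices m. v (pt m n) = v (fst p)"])
  show "(\<exists>p\<in>vertices m. v (pt m (n + 2 * 5 ^ m)) = v (fst p)) \<longleftrightarrow>
        (\<exists>p\<in>vertices m. v (pt m n) = v (fst p))" for n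
    by (simp add: graph_function_period[OF v])
  fix n :: int assume n: "0 \<le> n" "n < 2 * 5 ^ m"
  show "\<exists>p\<in>vertices m. v (pt m n) = v (fst p)"
  proof -
    \<comment> \<open>Numerators of vertices run from \<open>1\<close> to \<open>2 * 5 ^ m\<close>, so the origin is listed at the upper end.\<close>
    define n' where "n' = (if n = 0 then n + 2 * 5 ^ m else n)"
    have "v (pt m n') = v (pt m n)" by (simp add: n'_def graph_function_period[OF v, of 0, simplified])
    moreover have "n' \<in> {1..2 * 5 ^ m}" using n by (auto simp: n'_def)
    then obtain p where "p \<in> vertices m" "pt m n' = fst p \<or> pt m n' = snd p"
      using vertices_cover by blast
    ultimately show ?thesis
      using graph_function_vertex[OF v, of "fst p" "snd p"] by (intro bexI[of _ p]) auto
  qed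
qed simp

section \<open>Spectral decimation\<close>

definition residual :: "nat \<Rightarrow> (real \<Rightarrow> real) \<Rightarrow> real \<Rightarrow> real \<times> real \<Rightarrow> real" where
  "residual m v \<mu> p = - graph_laplacian m v p - \<mu> * v (fst p)"

lemma residual_pt:
  "residual m v \<mu> (pt m a, pt m b) =
     (4 - \<mu>) * v (pt m a) - v (pt m (a + 1)) - v (pt m (a - 1)) - v (pt m (b + 1)) - v (pt m (b - 1))"
proof -
  have h: "pt m n + 1 / (2 * 5 ^ m) = pt m (n + 1)" "pt m n - 1 / (2 * 5 ^ m) = pt m (n - 1)" for n
    by (simp_all add: pt_def add_divide_distrib diff_divide_distrib)
  show ?thesis
    unfolding residual_def graph_laplacian_def neighbours_def Let_def prod.case h
    by (simp add: algebra_simps)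
qed

lemma graph_eigenfunction_iff_residual:
  "graph_eigenfunction m v \<mu> \<longleftrightarrow>
     graph_function m v \<and> (\<exists>n. v (pt m n) \<noteq> 0) \<and> (\<forall>p\<in>vertices m. residual m v \<mu> p = 0)"
  by (simp add: graph_eigenfunction_def residual_def)

text \<open>
  The defect at the new vertex \<open>A\<close> (for \<open>c = (1, 2)\<close>) or \<open>B\<close> (for \<open>c = (3, 4)\<close>) on the edge from \<open>j\<close> to
  \<open>j + 1\<close> of level \<open>m\<close>.  The integer \<open>j\<close> is arbitrary, which lets the edges on both sides of a point \<open>a\<close>
  be addressed as \<open>a\<close> and \<open>a - 1\<close>.
\<close>

definition new_residual :: "nat \<Rightarrow> (real \<Rightarrow> real) \<Rightarrow> real \<Rightarrow> int \<times> int \<Rightarrow> int \<Rightarrow> real" where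
  "new_residual m v \<mu> c j = residual (Suc m) v \<mu> (pt (Suc m) (5 * j + fst c), pt (Suc m) (5 * j + snd c))"

lemma new_residual_bound:
  assumes v: "graph_function (Suc m) v" and ab: "(a, b) \<in> {(1, 2), (3, 4)}"
    and e: "\<And>p. p \<in> vertices (Suc m) \<Longrightarrow> \<bar>residual (Suc m) v \<mu> p\<bar> \<le> e"
  shows "\<bar>new_residual m v \<mu> (a, b) j\<bar> \<le> e"
proof (rule all_int_of_period[where N = "2 * 5 ^ m" and n = j
      and Q = "\<lambda>j. \<bar>new_residual m v \<mu> (a, b) j\<bar> \<le> e"])
  fix n :: int
  have per: "v (pt (Suc m) (5 * (n + 2 * 5 ^ m) + i)) = v (pt (Suc m) (5 * n + i))" for i
    using graph_function_period[OF v, of "5 * n + i"] by (simp add: algebra_simps)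
  show "\<bar>new_residual m v \<mu> (a, b) (n + 2 * 5 ^ m)\<bar> \<le> e \<longleftrightarrow> \<bar>new_residual m v \<mu> (a, b) n\<bar> \<le> e"
    unfolding new_residual_def residual_pt fst_conv snd_conv add.assoc add_diff_eq[symmetric] per[unfolded add.assoc] ..
  show "\<bar>new_residual m v \<mu> (a, b) n\<bar> \<le> e" if "0 \<le> n" "n < 2 * 5 ^ m"
    using e new_vertex[OF that ab] by (simp add: new_residual_def)
qed simp

text \<open>
  Two of the four neighbours of a new vertex are the vertex itself, by its loop; this lowers the
  coefficient \<open>4 - \<mu>\<close> to \<open>2 - \<mu>\<close>.
\<close>

lemma new_residual_eqs:
  assumes v: "graph_function (Suc m) v"
  shows "new_residual m v \<mu> (1, 2) j =
      (2 - \<mu>) * v (pt (Suc m) (5 * j + 1)) - v (pt m j) - v (pt (Suc m) (5 * j + 4))"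
    and "new_residual m v \<mu> (3, 4) j =
      (2 - \<mu>) * v (pt (Suc m) (5 * j + 4)) - v (pt (Suc m) (5 * j + 1)) - v (pt m (j + 1))"
proof -
  have vals: "v (pt (Suc m) (5 * j + 2)) = v (pt (Suc m) (5 * j + 1))"
       "v (pt (Suc m) (5 * j + 3)) = v (pt (Suc m) (5 * j + 4))"
    using graph_function_new_vertex[OF v, of 1 2 j] graph_function_new_vertex[OF v, of 3 4 j] by auto
  have shift: "5 * j + 1 + 1 = 5 * j + 2" "5 * j + 1 - 1 = 5 * j" "5 * j + 2 + 1 = 5 * j + 3"
    "5 * j + 2 - 1 = 5 * j + 1" "5 * j + 3 + 1 = 5 * j + 4" "5 * j + 3 - 1 = 5 * j + 2"
    "5 * j + 4 + 1 = 5 * (j + 1)" "5 * j + 4 - 1 = 5 * j + 3" by simp_all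
  show "new_residual m v \<mu> (1, 2) j =
      (2 - \<mu>) * v (pt (Suc m) (5 * j + 1)) - v (pt m j) - v (pt (Suc m) (5 * j + 4))"
    unfolding new_residual_def fst_conv snd_conv residual_pt shift pt_Suc_5 vals by algebra
  show "new_residual m v \<mu> (3, 4) j =
      (2 - \<mu>) * v (pt (Suc m) (5 * j + 4)) - v (pt (Suc m) (5 * j + 1)) - v (pt m (j + 1))"
    unfolding new_residual_def fst_conv snd_conv residual_pt shift pt_Suc_5 vals by algebra
qed

text \<open>
  Solving the equations at \<open>A\<close> and \<open>B\<close>, a linear system with determinant
  \<open>(2 - \<mu>)\<^sup>2 - 1 = (1 - \<mu>) (3 - \<mu>)\<close>, in terms of the end points of the edge.
\<close>

lemma new_residual_elimination:
  assumes v: "graph_function (Suc m) v"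
  shows "(2 - \<mu>) * new_residual m v \<mu> (1, 2) j + new_residual m v \<mu> (3, 4) j =
      (1 - \<mu>) * (3 - \<mu>) * v (pt (Suc m) (5 * j + 1)) - (2 - \<mu>) * v (pt m j) - v (pt m (j + 1))"
    and "(2 - \<mu>) * new_residual m v \<mu> (3, 4) j + new_residual m v \<mu> (1, 2) j =
      (1 - \<mu>) * (3 - \<mu>) * v (pt (Suc m) (5 * j + 4)) - (2 - \<mu>) * v (pt m (j + 1)) - v (pt m j)"
proof -
  have "(2 - \<mu>) * ((2 - \<mu>) * A - x - B) + ((2 - \<mu>) * B - A - y) =
      (1 - \<mu>) * (3 - \<mu>) * A - (2 - \<mu>) * x - y" for A B x y :: real
    by (simp add: algebra_simps)
  note elim = this
  show "(2 - \<mu>) * new_residual m v \<mu> (1, 2) j + new_residual m v \<mu> (3, 4) j =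
      (1 - \<mu>) * (3 - \<mu>) * v (pt (Suc m) (5 * j + 1)) - (2 - \<mu>) * v (pt m j) - v (pt m (j + 1))"
    unfolding new_residual_eqs[OF v] by (rule elim)
  show "(2 - \<mu>) * new_residual m v \<mu> (3, 4) j + new_residual m v \<mu> (1, 2) j =
      (1 - \<mu>) * (3 - \<mu>) * v (pt (Suc m) (5 * j + 4)) - (2 - \<mu>) * v (pt m (j + 1)) - v (pt m j)"
    unfolding new_residual_eqs[OF v] using elim[of "v (pt (Suc m) (5 * j + 4))"] by (simp add: diff_right_commute)
qed

text \<open>
  Multiply the equation at the old vertex by \<open>(1 - \<mu>) (3 - \<mu>)\<close> and eliminate its four new neighbours,
  namely \<open>A\<close> on the edges \<open>a\<close>, \<open>b\<close> and \<open>B\<close> on the edges \<open>a - 1\<close>, \<open>b - 1\<close>.  The value at the old vertex ends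
  up with the coefficient \<open>(1 - \<mu>) (3 - \<mu>) (4 - \<mu>) - 4 (2 - \<mu>) = 4 - R \<mu>\<close>.  Nothing is divided by, so the
  identity includes \<open>\<mu> = 1\<close> and \<open>\<mu> = 3\<close>.
\<close>

lemma residual_decimation:
  assumes v: "graph_function (Suc m) v" and eq: "v (pt m a) = v (pt m b)"
  shows "residual m v (R \<mu>) (pt m a, pt m b) =
      (1 - \<mu>) * (3 - \<mu>) * residual (Suc m) v \<mu> (pt m a, pt m b)
      + (2 - \<mu>) * (new_residual m v \<mu> (1, 2) a + new_residual m v \<mu> (3, 4) (a - 1)
                  + new_residual m v \<mu> (1, 2) b + new_residual m v \<mu> (3, 4) (b - 1))
      + (new_residual m v \<mu> (3, 4) a + new_residual m v \<mu> (1, 2) (a - 1)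
         + new_residual m v \<mu> (3, 4) b + new_residual m v \<mu> (1, 2) (b - 1))"
proof -
  have old: "residual (Suc m) v \<mu> (pt m a, pt m b) = (4 - \<mu>) * v (pt m a)
      - v (pt (Suc m) (5 * a + 1)) - v (pt (Suc m) (5 * (a - 1) + 4))
      - v (pt (Suc m) (5 * b + 1)) - v (pt (Suc m) (5 * (b - 1) + 4))"
  proof -
    have "5 * (n - 1) + 4 = 5 * n - 1" for n :: int by simp
    then show ?thesis
      using residual_pt[of "Suc m" v \<mu> "5 * a" "5 * b"] unfolding pt_Suc_5 by simp
  qed
  have combine: "(4 - R \<mu>) * x - y1 - y2 - y3 - y4 =
      (1 - \<mu>) * (3 - \<mu>) * ((4 - \<mu>) * x - A1 - A2 - A3 - A4) + (2 - \<mu>) * (e1 + e2 + e3 + e4)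
      + (d1 + d2 + d3 + d4)"
    if "(2 - \<mu>) * e1 + d1 = (1 - \<mu>) * (3 - \<mu>) * A1 - (2 - \<mu>) * x - y1"
      "(2 - \<mu>) * e2 + d2 = (1 - \<mu>) * (3 - \<mu>) * A2 - (2 - \<mu>) * x - y2"
      "(2 - \<mu>) * e3 + d3 = (1 - \<mu>) * (3 - \<mu>) * A3 - (2 - \<mu>) * x - y3"
      "(2 - \<mu>) * e4 + d4 = (1 - \<mu>) * (3 - \<mu>) * A4 - (2 - \<mu>) * x - y4"
    for x y1 y2 y3 y4 A1 A2 A3 A4 e1 e2 e3 e4 d1 d2 d3 d4
  proof -
    have "(4 - R \<mu>) * x = (1 - \<mu>) * (3 - \<mu>) * ((4 - \<mu>) * x) - 4 * ((2 - \<mu>) * x)"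
      by (simp add: R_def algebra_simps)
    with that show ?thesis unfolding distrib_left right_diff_distrib by linarith
  qed
  show ?thesis
    unfolding old residual_pt
    using new_residual_elimination(1)[OF v, of \<mu> a] new_residual_elimination(2)[OF v, of \<mu> "a - 1"]
      new_residual_elimination(1)[OF v, of \<mu> b] new_residual_elimination(2)[OF v, of \<mu> "b - 1"]
    by (intro combine) (simp_all add: eq)
qed

text \<open>
  For \<open>0 \<le> \<mu> \<le> 1\<close> all coefficients in the decimation identity are nonnegative, and their sum
  \<open>(1 - \<mu>) (3 - \<mu>) + 4 (2 - \<mu>) + 4 = 15 - \<mu> (8 - \<mu>)\<close> does not exceed the factor \<open>15\<close> by which the Laplacians are
  renormalised.  This coincidence is what lets the error survive arbitrarily many steps.
\<close>

lemma residual_decimation_bound: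
  assumes v: "graph_function (Suc m) v" and \<mu>: "0 \<le> \<mu>" "\<mu> \<le> 1"
    and e: "\<And>p. p \<in> vertices (Suc m) \<Longrightarrow> \<bar>residual (Suc m) v \<mu> p\<bar> \<le> e"
    and p: "p \<in> vertices m"
  shows "\<bar>residual m v (R \<mu>) p\<bar> \<le> 15 * e"
proof -
  obtain a b where ab: "p = (pt m a, pt m b)" using p by (rule vertexE)
  have eq: "v (pt m a) = v (pt m b)"
    using graph_function_vertex[OF graph_function_SucD[OF v]] p ab by blast
  have n: "\<bar>new_residual m v \<mu> (1, 2) j\<bar> \<le> e" "\<bar>new_residual m v \<mu> (3, 4) j\<bar> \<le> e" for j
    by (rule new_residual_bound[OF v _ e]; simp)+
  have o: "\<bar>residual (Suc m) v \<mu> (pt m a, pt m b)\<bar> \<le> e"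
    using e vertices_Suc[of m] p ab by blast
  have e0: "0 \<le> e" using o by linarith
  have c: "0 \<le> (1 - \<mu>) * (3 - \<mu>)" "0 \<le> 2 - \<mu>" using \<mu> by auto
  let ?r = "residual (Suc m) v \<mu> (pt m a, pt m b)"
  let ?s = "new_residual m v \<mu> (1, 2) a + new_residual m v \<mu> (3, 4) (a - 1)
          + new_residual m v \<mu> (1, 2) b + new_residual m v \<mu> (3, 4) (b - 1)"
  let ?t = "new_residual m v \<mu> (3, 4) a + new_residual m v \<mu> (1, 2) (a - 1)
          + new_residual m v \<mu> (3, 4) b + new_residual m v \<mu> (1, 2) (b - 1)"
  have s: "\<bar>?s\<bar> \<le> 4 * e"
    using n(1)[of a] n(2)[of "a - 1"] n(1)[of b] n(2)[of "b - 1"] by linarith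
  have t: "\<bar>?t\<bar> \<le> 4 * e"
    using n(2)[of a] n(1)[of "a - 1"] n(2)[of b] n(1)[of "b - 1"] by linarith
  have "\<bar>residual m v (R \<mu>) p\<bar> \<le> \<bar>(1 - \<mu>) * (3 - \<mu>) * ?r\<bar> + \<bar>(2 - \<mu>) * ?s\<bar> + \<bar>?t\<bar>"
    unfolding ab residual_decimation[OF v eq] by linarith
  also have "\<dots> \<le> (1 - \<mu>) * (3 - \<mu>) * e + (2 - \<mu>) * (4 * e) + 4 * e"
    unfolding abs_mult[of _ ?r] abs_mult[of _ ?s] abs_of_nonneg[OF c(1)] abs_of_nonneg[OF c(2)]
    using c o s t by (intro add_mono mult_left_mono)
  also have "\<dots> = 15 * e - \<mu> * (8 - \<mu>) * e"
    by algebra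
  also have "\<dots> \<le> 15 * e" using \<mu> e0 by simp
  finally show ?thesis .
qed

lemma R_bounds:
  assumes "0 \<le> \<mu>" "\<mu> \<le> 1" shows "0 \<le> R \<mu>" "R \<mu> \<le> 15 * \<mu>"
proof -
  show "0 \<le> R \<mu>" using assms by (simp add: R_def)
  have "15 * \<mu> - R \<mu> = \<mu> * \<mu> * (8 - \<mu>)" unfolding R_def by algebra
  moreover have "0 \<le> \<mu> * \<mu> * (8 - \<mu>)" using assms by simp
  ultimately show "R \<mu> \<le> 15 * \<mu>" by linarith
qed

text \<open>
  The condition \<open>15 ^ k * \<mu> \<le> 1\<close> keeps all iterates in \<open>[0, 1]\<close>, since \<open>R\<close> enlarges them at most by the
  factor \<open>15\<close>.
\<close>

lemma residual_iterated_bound: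
  assumes "\<And>k. graph_function k v" "p \<in> vertices m"
  shows "0 \<le> \<mu> \<Longrightarrow> 15 ^ k * \<mu> \<le> 1 \<Longrightarrow> (\<And>p. p \<in> vertices (m + k) \<Longrightarrow> \<bar>residual (m + k) v \<mu> p\<bar> \<le> e)
    \<Longrightarrow> \<bar>residual m v ((R ^^ k) \<mu>) p\<bar> \<le> 15 ^ k * e"
proof (induction k arbitrary: \<mu> e)
  case 0
  then show ?case using assms by simp
next
  case (Suc k)
  have "1 * \<mu> \<le> 15 ^ Suc k * \<mu>" using Suc.prems(1) by (intro mult_right_mono one_le_power) auto
  then have \<mu>: "0 \<le> \<mu>" "\<mu> \<le> 1" using Suc.prems by linarith+
  have "15 ^ k * R \<mu> \<le> 15 ^ k * (15 * \<mu>)"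
    using R_bounds[OF \<mu>] by (intro mult_left_mono) auto
  also have "\<dots> = 15 ^ Suc k * \<mu>" by simp
  also note Suc.prems(2)
  finally have k: "15 ^ k * R \<mu> \<le> 1" .
  have "\<bar>residual m v ((R ^^ k) (R \<mu>)) p\<bar> \<le> 15 ^ k * (15 * e)"
  proof (rule Suc.IH[OF R_bounds(1)[OF \<mu>] k])
    fix q assume "q \<in> vertices (m + k)"
    then show "\<bar>residual (m + k) v (R \<mu>) q\<bar> \<le> 15 * e"
      using residual_decimation_bound[OF assms(1) \<mu>, of "m + k" e q] Suc.prems(3) by simp
  qed
  then show ?case by (simp add: funpow_Suc_right mult.assoc mult.left_commute del: funpow.simps)
qed

section \<open>Eigenvalues of the graph Laplacians\<close>

text \<open>
  The maximum principle: where \<open>\<bar>v\<bar>\<close> is largest, each of the four terms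
  \<open>v x * (v x - v z)\<close> lies between \<open>0\<close> and \<open>2 (v x)\<^sup>2\<close>.
\<close>

lemma vertex_of_maximal_modulus:
  assumes v: "graph_function m v"
  obtains p where "p \<in> vertices m" "\<And>n. \<bar>v (pt m n)\<bar> \<le> \<bar>v (fst p)\<bar>"
    "0 \<le> v (fst p) * - graph_laplacian m v p"
    "v (fst p) * - graph_laplacian m v p \<le> 8 * (v (fst p))\<^sup>2"
proof -
  let ?f = "\<lambda>p. \<bar>v (fst p)\<bar>"
  have fin: "finite (?f ` vertices m)" using finite_vertices by simp
  have "?f ` vertices m \<noteq> {}" using graph_function_value_at_vertex[OF v] by blast
  from Max_in[OF fin this] obtain p where p: "p \<in> vertices m" "Max (?f ` vertices m) = ?f p" by auto
  have max: "\<bar>v (pt m n)\<bar> \<le> ?f p" for n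
    using graph_function_value_at_vertex[OF v, of n] Max_ge[OF fin] p(2) by fastforce
  obtain a b where ab: "p = (pt m a, pt m b)" using p(1) by (rule vertexE)
  let ?x = "v (pt m a)"
  have prod: "?x * v (pt m n) \<le> ?x\<^sup>2" "- ?x\<^sup>2 \<le> ?x * v (pt m n)" for n
  proof -
    have "\<bar>?x * v (pt m n)\<bar> \<le> \<bar>?x\<bar> * \<bar>?x\<bar>"
      unfolding abs_mult using max[of n] ab by (intro mult_left_mono) auto
    then have "\<bar>?x * v (pt m n)\<bar> \<le> ?x\<^sup>2" by (simp add: power2_eq_square)
    then show "?x * v (pt m n) \<le> ?x\<^sup>2" "- ?x\<^sup>2 \<le> ?x * v (pt m n)" by linarith+
  qed
  have "- graph_laplacian m v p =
      4 * ?x - v (pt m (a + 1)) - v (pt m (a - 1)) - v (pt m (b + 1)) - v (pt m (b - 1))"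
    using residual_pt[of m v 0 a b] ab by (simp add: residual_def)
  then have "?x * - graph_laplacian m v p = 4 * ?x\<^sup>2 - ?x * v (pt m (a + 1)) - ?x * v (pt m (a - 1))
      - ?x * v (pt m (b + 1)) - ?x * v (pt m (b - 1))"
    by algebra
  then have "0 \<le> ?x * - graph_laplacian m v p" "?x * - graph_laplacian m v p \<le> 8 * ?x\<^sup>2"
    using prod[of "a + 1"] prod[of "a - 1"] prod[of "b + 1"] prod[of "b - 1"] by linarith+
  then show ?thesis using that[OF p(1) max] ab by simp
qed

lemma graph_eigenvalue_bounds:
  assumes "graph_eigenfunction m v \<mu>"
  shows "0 \<le> \<mu>" "\<mu> \<le> 8"
proof -
  have v: "graph_function m v" and eig: "p \<in> vertices m \<Longrightarrow> - graph_laplacian m v p = \<mu> * v (fst p)"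
    and "\<exists>n. v (pt m n) \<noteq> 0" for p using assms by (auto simp: graph_eigenfunction_def)
  then obtain n where n: "v (pt m n) \<noteq> 0" by auto
  obtain p where p: "p \<in> vertices m" "\<And>n. \<bar>v (pt m n)\<bar> \<le> \<bar>v (fst p)\<bar>"
    "0 \<le> v (fst p) * - graph_laplacian m v p"
    "v (fst p) * - graph_laplacian m v p \<le> 8 * (v (fst p))\<^sup>2"
    using vertex_of_maximal_modulus[OF v] by blast
  have pos: "0 < (v (fst p))\<^sup>2" using n p(2)[of n] by auto
  have "v (fst p) * - graph_laplacian m v p = \<mu> * (v (fst p))\<^sup>2"
    unfolding eig[OF p(1)] by (simp add: power2_eq_square)
  then have "0 \<le> \<mu> * (v (fst p))\<^sup>2" "\<mu> * (v (fst p))\<^sup>2 \<le> 8 * (v (fst p))\<^sup>2"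
    using p(3,4) by simp_all
  then show "0 \<le> \<mu>" "\<mu> \<le> 8" using pos by (simp_all add: zero_le_mult_iff)
qed

lemma graph_eigenvalue_unique:
  assumes "graph_eigenfunction m v \<mu>" "\<forall>p\<in>vertices m. residual m v \<nu> p = 0"
  shows "\<mu> = \<nu>"
proof -
  obtain n where n: "v (pt m n) \<noteq> 0" and "graph_function m v"
    using assms(1) by (auto simp: graph_eigenfunction_def)
  then obtain p where "p \<in> vertices m" "v (fst p) \<noteq> 0"
    using graph_function_value_at_vertex[of m v n] by auto
  then have "\<mu> * v (fst p) = \<nu> * v (fst p)"
    using assms by (auto simp: graph_eigenfunction_def residual_def)
  with \<open>v (fst p) \<noteq> 0\<close> show ?thesis by simp
qed

lemma eigenfunction_new_residual:
  assumes "graph_eigenfunction (Suc m) v \<mu>" "(a, b) \<in> {(1, 2), (3, 4)}"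
  shows "new_residual m v \<mu> (a, b) j = 0"
  using new_residual_bound[of m v a b \<mu> 0 j] assms by (auto simp: graph_eigenfunction_iff_residual)

lemma decimation_residual:
  assumes eig: "graph_eigenfunction (Suc m) v \<mu>" and p: "p \<in> vertices m"
  shows "residual m v (R \<mu>) p = 0"
proof -
  have v: "graph_function (Suc m) v" using eig by (simp add: graph_eigenfunction_def)
  obtain a b where ab: "p = (pt m a, pt m b)" using p by (rule vertexE)
  have eq: "v (pt m a) = v (pt m b)"
    using graph_function_vertex[OF graph_function_SucD[OF v]] p ab by blast
  have "residual (Suc m) v \<mu> p = 0"
    using eig p vertices_Suc[of m] by (auto simp: graph_eigenfunction_iff_residual)
  then show ?thesis
    unfolding ab residual_decimation[OF v eq] by (simp add: eigenfunction_new_residual[OF eig])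
qed

lemma decimation_edge:
  assumes eig: "graph_eigenfunction (Suc m) v \<mu>"
  shows "(2 - \<mu>) * v (pt (Suc m) (5 * j + 1)) = v (pt m j) + v (pt (Suc m) (5 * j + 4))"
    and "(2 - \<mu>) * v (pt (Suc m) (5 * j + 4)) = v (pt (Suc m) (5 * j + 1)) + v (pt m (j + 1))"
proof -
  have v: "graph_function (Suc m) v" using eig by (simp add: graph_eigenfunction_def)
  show "(2 - \<mu>) * v (pt (Suc m) (5 * j + 1)) = v (pt m j) + v (pt (Suc m) (5 * j + 4))"
    "(2 - \<mu>) * v (pt (Suc m) (5 * j + 4)) = v (pt (Suc m) (5 * j + 1)) + v (pt m (j + 1))"
    using eigenfunction_new_residual[OF eig, of 1 2 j] eigenfunction_new_residual[OF eig, of 3 4 j]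
    unfolding new_residual_eqs[OF v] by simp_all
qed

text \<open>
  A function vanishing at both ends of an edge satisfies \<open>(1 - \<mu>) (3 - \<mu>) A = 0\<close> there, so an
  eigenfunction that vanishes on the previous level has eigenvalue \<open>1\<close> or \<open>3\<close>.
\<close>

lemma eigenfunction_decimation:
  assumes eig: "graph_eigenfunction (Suc m) v \<mu>" and \<mu>: "\<mu> \<noteq> 1" "\<mu> \<noteq> 3"
  shows "graph_eigenfunction m v (R \<mu>)"
proof -
  have v: "graph_function (Suc m) v" using eig by (simp add: graph_eigenfunction_def)
  have "\<exists>n. v (pt m n) \<noteq> 0"
  proof (rule ccontr)
    assume "\<not> ?thesis"
    then have 0: "v (pt m n) = 0" for n by auto
    have z: "v (pt (Suc m) (5 * j + 1)) = 0 \<and> v (pt (Suc m) (5 * j + 4)) = 0" for j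
    proof -
      let ?A = "v (pt (Suc m) (5 * j + 1))" and ?B = "v (pt (Suc m) (5 * j + 4))"
      have AB: "(2 - \<mu>) * ?A = ?B" "(2 - \<mu>) * ?B = ?A" using decimation_edge[OF eig, of j] 0 by auto
      have "(1 - \<mu>) * (3 - \<mu>) * ?A = (2 - \<mu>) * ((2 - \<mu>) * ?A) - ?A" by algebra
      also have "\<dots> = 0" unfolding AB by simp
      finally have "(1 - \<mu>) * (3 - \<mu>) * ?A = 0" .
      with \<mu> AB show ?thesis by auto
    qed
    have "v (pt (Suc m) n) = 0" for n
    proof -
      obtain j r where n: "n = 5 * j + r" and r: "r \<in> {0, 1, 2, 3, 4}" by (rule int_mod_5_cases)
      show ?thesis
        using z[of j] 0[of j] r graph_function_new_vertex[OF v, of 1 2 j]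
          graph_function_new_vertex[OF v, of 3 4 j] unfolding n by auto
    qed
    then show False using eig by (auto simp: graph_eigenfunction_def)
  qed
  then show ?thesis
    using graph_function_SucD[OF v] decimation_residual[OF eig]
    by (simp add: graph_eigenfunction_iff_residual)
qed

text \<open>
  For \<open>\<mu> = 3\<close> the equations at the two new vertices of an edge read \<open>A + B = - x\<close> and \<open>A + B = - y\<close>.  So \<open>v\<close>
  is a constant \<open>c\<close> on the previous level and \<open>A + B = - c\<close> on each edge.  The equation at an old vertex says
  that the four new neighbours add up to \<open>c\<close>.  Summing over all vertices counts every \<open>A\<close> and every \<open>B\<close>
  once; there are twice as many edges as vertices, whence \<open>c = - 2 c\<close>.
\<close>

lemma eigenvalue_3_vanishes_on_previous_level:
  assumes eig: "graph_eigenfunction (Suc m) v 3"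
  shows "v (pt m n) = 0"
proof -
  have v: "graph_function (Suc m) v" using eig by (simp add: graph_eigenfunction_def)
  define c where "c = v (pt m 0)"
  let ?A = "\<lambda>j. v (pt (Suc m) (5 * j + 1))" and ?B = "\<lambda>j. v (pt (Suc m) (5 * j + 4))"
  have AB: "?A j + ?B j = - v (pt m j)" and step: "v (pt m (j + 1)) = v (pt m j)" for j
    using decimation_edge[OF eig, of j] by auto
  have c: "v (pt m j) = c" for j
  proof (rule all_int_of_period[where N = 1 and n = j and Q = "\<lambda>j. v (pt m j) = c"])
    fix n :: int assume "0 \<le> n" "n < 1"
    then have "n = 0" by simp
    then show "v (pt m n) = c" by (simp add: c_def)
  qed (simp_all add: step)
  let ?h = "1 / (2 * 5 ^ Suc m) :: real"
  \<comment> \<open>A vertex consists of two points, so each of them receives half of the equation at the vertex.\<close>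
  define g where "g = (\<lambda>x. v (x + ?h) + v (x - ?h) - c / 2)"
  have g: "g (pt m j) = ?A j + ?B (j - 1) - c / 2" for j
  proof -
    have "pt m j + ?h = pt (Suc m) (5 * j + 1)" "pt m j - ?h = pt (Suc m) (5 * (j - 1) + 4)"
      by (simp_all add: pt_def field_simps)
    then show ?thesis by (simp add: g_def)
  qed
  have "(\<Sum>j\<in>{1..2 * 5 ^ m}. g (pt m j)) = 0"
  proof (rule sum_over_vertices_eq_0)
    fix p assume p: "p \<in> vertices m"
    obtain a b where ab: "p = (pt m a, pt m b)" using p by (rule vertexE)
    have "residual (Suc m) v 3 (pt (Suc m) (5 * a), pt (Suc m) (5 * b)) = 0"
      using eig p vertices_Suc[of m] ab by (auto simp: graph_eigenfunction_iff_residual)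
    moreover have "5 * (n - 1) + 4 = 5 * n - 1" for n :: int by simp
    moreover have "v (pt (Suc m) (5 * a)) = c" using c by simp
    ultimately show "g (fst p) + g (snd p) = 0"
      unfolding residual_pt ab fst_conv snd_conv g by simp
  qed
  \<comment> \<open>Regroup the neighbours of the points as the new vertices of the edges.\<close>
  moreover have "(\<Sum>j\<in>{1..2 * 5 ^ m}. ?B (j - 1)) = (\<Sum>j\<in>{1..2 * 5 ^ m}. ?B j)"
  proof -
    have "(\<Sum>j\<in>{1..int M}. ?B (j - 1)) = (\<Sum>j\<in>{1..int M}. ?B j) + ?B 0 - ?B (int M)" for M
    proof (induction M)
      case (Suc M)
      have "{1..int (Suc M)} = insert (int M + 1) {1..int M}" by auto
      then show ?case using Suc by (simp add: algebra_simps)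
    qed simp
    from this[of "2 * 5 ^ m"] show ?thesis
      using graph_function_period[OF v, of 4] by (simp add: algebra_simps)
  qed
  ultimately have "(\<Sum>j\<in>{1..2 * 5 ^ m}. ?A j + ?B j - c / 2) = 0"
    unfolding g by (simp add: sum.distrib sum_subtractf)
  then have "c = 0" unfolding AB c by simp
  then show ?thesis using c by simp
qed

lemma level_0_eigenvalue:
  assumes "graph_eigenfunction 0 v \<mu>"
  shows "\<mu> = 0"
proof -
  have v: "graph_function 0 v" using assms by (simp add: graph_eigenfunction_def)
  have val: "v (pt 0 n) = v (pt 0 1)" for n
  proof (rule all_int_of_period[where N = 2 and n = n and Q = "\<lambda>n. v (pt 0 n) = v (pt 0 1)"])
    show "v (pt 0 (n + 2)) = v (pt 0 1) \<longleftrightarrow> v (pt 0 n) = v (pt 0 1)" for n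
      using graph_function_period[OF v, of n] by simp
    show "v (pt 0 n) = v (pt 0 1)" if "0 \<le> n" "n < 2" for n
    proof -
      have "n = 0 \<or> n = 1" using that by auto
      then show ?thesis
        using graph_function_vertex[OF v vertex_0] graph_function_period[OF v, of 0] by auto
    qed
  qed simp
  have "residual 0 v 0 p = 0" if p: "p \<in> vertices 0" for p
  proof -
    obtain a b where "p = (pt 0 a, pt 0 b)" using p by (rule vertexE)
    then show ?thesis
      using val[of a] val[of "a + 1"] val[of "a - 1"] val[of "b + 1"] val[of "b - 1"]
      by (simp add: residual_pt)
  qed
  then show ?thesis using graph_eigenvalue_unique[OF assms] by blast
qed

section \<open>The inverse branches\<close>

text \<open>
  The values of \<open>R\<close> at \<open>0, 1, 6/5, 3, 4, 6\<close> are \<open>0, 8, 1026/125, 0, -4, 18\<close>, where \<open>1026/125 > 8\<close>; so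
  \<open>R\<close> takes each value in \<open>[0, 8]\<close> in each of \<open>[0, 1]\<close>, \<open>[6/5, 3]\<close> and \<open>[4, 6]\<close>.  A cubic has no further roots.
\<close>

lemma R_roots:
  assumes "0 \<le> y" "y \<le> 8"
  obtains r1 r2 r3 where "r1 \<le> 1" "r1 < r2" "r2 < r3" "{x. R x = y} = {r1, r2, r3}"
proof -
  have cont: "continuous_on S R" for S
    unfolding R_def[abs_def] by (intro continuous_intros)
  obtain r1 where r1: "0 \<le> r1" "r1 \<le> 1" "R r1 = y"
    using IVT'[of R 0 y 1] cont assms by (auto simp: R_def)
  obtain r2 where r2: "6/5 \<le> r2" "r2 \<le> 3" "R r2 = y"
    using IVT2'[of R 3 y "6/5"] cont assms by (auto simp: R_def)
  obtain r3 where r3: "4 \<le> r3" "r3 \<le> 6" "R r3 = y"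
    using IVT'[of R 4 y 6] cont assms by (auto simp: R_def)
  have ne: "r1 \<noteq> r2" "r2 \<noteq> r3" "r1 \<noteq> r3" using r1 r2 r3 by auto
  have quot: "x * x + x * r + r * r - 8 * (x + r) + 15 = 0" if "R x = R r" "x \<noteq> r" for x r
  proof -
    have "(x - r) * (x * x + x * r + r * r - 8 * (x + r) + 15) = R x - R r"
      unfolding R_def by algebra
    then show ?thesis using that by simp
  qed
  have "x = r1 \<or> x = r2 \<or> x = r3" if "R x = y" for x
  proof (rule ccontr)
    assume "\<not> ?thesis"
    then have q: "x * x + x * r + r * r - 8 * (x + r) + 15 = 0" if "r \<in> {r1, r2, r3}" for r
      using that quot[of x r] \<open>R x = y\<close> r1 r2 r3 by auto
    \<comment> \<open>Vieta: three distinct solutions of the monic cubic equation add up to \<open>8\<close>.\<close>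
    have d: "x + r + s = 8" if "r \<in> {r1, r2, r3}" "s \<in> {r1, r2, r3}" "r \<noteq> s" for r s
    proof -
      have "(r - s) * (x + r + s - 8) = 0" using q[OF that(1)] q[OF that(2)] by algebra
      with that show ?thesis by simp
    qed
    have "x + r1 + r2 = 8" "x + r1 + r3 = 8" using d[of r1 r2] d[of r1 r3] ne by auto
    then show False using ne by simp
  qed
  then have "{x. R x = y} = {r1, r2, r3}" using r1 r2 r3 by auto
  then show ?thesis using that[of r1 r2 r3] r1 r2 r3 by simp
qed

lemma R_preimage_branch:
  assumes "0 \<le> R x" "R x \<le> 8"
  shows "\<exists>i\<in>{1, 2, 3}. x = \<phi> i (R x)" and "x < 1 \<Longrightarrow> x = \<phi> 1 (R x)"
proof -
  obtain r1 r2 r3 where r: "r1 \<le> 1" "r1 < r2" "r2 < r3" "{z. R z = R x} = {r1, r2, r3}"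
    using R_roots[OF assms] by blast
  have "sorted_list_of_set {r1, r2, r3} = [r1, r2, r3]" using r by auto
  then have \<phi>: "\<phi> 1 (R x) = r1" "\<phi> 2 (R x) = r2" "\<phi> 3 (R x) = r3"
    by (simp_all add: \<phi>_def r(4))
  have "x \<in> {z. R z = R x}" by simp
  then have x: "x \<in> {r1, r2, r3}" unfolding r(4) .
  with \<phi> show "\<exists>i\<in>{1, 2, 3}. x = \<phi> i (R x)" by auto
  show "x = \<phi> 1 (R x)" if "x < 1"
  proof (rule ccontr)
    assume "x \<noteq> \<phi> 1 (R x)"
    then have "r1 < x" using x \<phi> r by auto
    have "R r1 = R x" using r(4) by blast
    \<comment> \<open>The second factor is the divided difference of \<open>R\<close>, arranged so that it is visibly positive on \<open>(-\<infinity>, 1]\<close>.\<close>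
    moreover have "R x - R r1 = (x - r1) * ((1 - x) * (7 - x - r1) + (1 - r1) * (6 - r1) + 2)"
      unfolding R_def by algebra
    moreover have "0 < (x - r1) * ((1 - x) * (7 - x - r1) + (1 - r1) * (6 - r1) + 2)"
      using \<open>r1 < x\<close> that r(1) by (intro mult_pos_pos add_nonneg_pos add_nonneg_nonneg) auto
    ultimately show False by linarith
  qed
qed

lemma \<phi>_2_0: "\<phi> 2 0 = 3"
proof -
  have "{x. R x = 0} = {0, 3, 5}" by (auto simp: R_def)
  then show ?thesis by (simp add: \<phi>_def)
qed

section \<open>Eigenfunctions on the fractal\<close>

lemma nonzero_at_level_point:
  assumes "continuous_on UNIV u" "u x \<noteq> (0 :: real)"
  shows "\<exists>m n. u (pt m n) \<noteq> 0"
proof -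
  have "isCont u x" using assms(1) by (simp add: continuous_on_eq_continuous_at)
  then obtain d where d: "0 < d" "\<And>y. y \<noteq> x \<and> dist y x < d \<Longrightarrow> dist (u y) (u x) < \<bar>u x\<bar>"
    using metric_LIM_D[of u "u x" x "\<bar>u x\<bar>"] assms(2) by (auto simp: isCont_def)
  obtain m where m: "(1 / 5) ^ m < d" using d(1) real_arch_pow_inv[of d "1/5"] by auto
  define n where "n = \<lfloor>x * (2 * 5 ^ m)\<rfloor>"
  have "\<bar>pt m n - x\<bar> = \<bar>n - x * (2 * 5 ^ m)\<bar> / (2 * 5 ^ m)"
    by (simp add: pt_def field_simps abs_divide)
  also have "\<dots> \<le> 1 / (2 * 5 ^ m)"
  proof (rule divide_right_mono)
    show "\<bar>n - x * (2 * 5 ^ m)\<bar> \<le> 1"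
      using floor_correct[of "x * (2 * 5 ^ m)"] unfolding n_def by linarith
  qed simp
  also have "\<dots> \<le> (1 / 5) ^ m" by (simp add: power_one_over field_simps)
  finally have "dist (pt m n) x < d" using m by (simp add: dist_real_def)
  then have "u (pt m n) \<noteq> 0"
    using d(2)[of "pt m n"] assms(2) by (cases "pt m n = x") (auto simp: dist_real_def)
  then show ?thesis by blast
qed

context
  fixes u :: "real \<Rightarrow> real" and lam :: real
  assumes eig: "vicsek_eigenfunction u lam"
begin

lemma eigenfunction_graph_function: "graph_function m u"
  using eig by (auto simp: vicsek_eigenfunction_def has_laplacian_def vicsek_continuous_def graph_function_def)

lemma eigenfunction_residual_tendsto_0:
  "\<exists>\<epsilon>. \<epsilon> \<longlonglongrightarrow> 0 \<and> (\<forall>m. \<forall>p\<in>vertices m. \<bar>15 ^ m * - graph_laplacian m u p - lam * u (fst p)\<bar> \<le> \<epsilon> m)"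
proof -
  obtain f where f: "has_laplacian u f" "\<And>x. f x = - lam * u x"
    using eig unfolding vicsek_eigenfunction_def by (metis minus_minus mult_minus_left)
  let ?g = "\<lambda>m p. \<bar>15 ^ m * graph_laplacian m u p - f (fst p)\<bar>"
  have "(\<lambda>m. SUP p\<in>vertices m. ?g m p) \<longlonglongrightarrow> 0"
    using f(1) by (simp add: has_laplacian_def)
  moreover have "\<bar>15 ^ m * - graph_laplacian m u p - lam * u (fst p)\<bar> \<le> (SUP p\<in>vertices m. ?g m p)"
    if "p \<in> vertices m" for m p
  proof -
    have "\<bar>15 ^ m * - graph_laplacian m u p - lam * u (fst p)\<bar> = ?g m p" by (simp add: f(2))
    also have "\<dots> \<le> (SUP p\<in>vertices m. ?g m p)"
      using that finite_vertices by (intro cSUP_upper) auto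
    finally show ?thesis .
  qed
  ultimately show ?thesis by blast
qed

lemma eigenfunction_nonzero_from_some_level:
  "\<exists>M. \<forall>m\<ge>M. \<exists>n. u (pt m n) \<noteq> 0"
proof -
  obtain x where "u x \<noteq> 0" "continuous_on UNIV u"
    using eig by (auto simp: vicsek_eigenfunction_def has_laplacian_def vicsek_continuous_def)
  then obtain M n where "u (pt M n) \<noteq> 0" using nonzero_at_level_point by blast
  then have "\<exists>n. u (pt m n) \<noteq> 0" if "M \<le> m" for m
    using pt_mono_level[OF that, of n] by metis
  then show ?thesis by blast
qed

text \<open>
  At a point where \<open>\<bar>u\<bar>\<close> is largest among the points of level \<open>m\<close>, \<open>- \<Delta>\<^sub>m u\<close> cannot have the sign opposite to
  \<open>u\<close>; for negative \<open>lam\<close> it would differ from \<open>lam * u\<close>, even after renormalisation, by at least \<open>\<bar>lam\<bar>\<close> times the maximum of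
  \<open>\<bar>u\<bar>\<close>, which does not tend to \<open>0\<close>.
\<close>

lemma eigenvalue_nonneg: "0 \<le> lam"
proof (rule ccontr)
  assume neg: "\<not> 0 \<le> lam"
  obtain \<epsilon> where \<epsilon>: "\<epsilon> \<longlonglongrightarrow> 0" "\<forall>m. \<forall>p\<in>vertices m. \<bar>15 ^ m * - graph_laplacian m u p - lam * u (fst p)\<bar> \<le> \<epsilon> m"
    using eigenfunction_residual_tendsto_0 by blast
  obtain M where "\<forall>m\<ge>M. \<exists>n. u (pt m n) \<noteq> 0" using eigenfunction_nonzero_from_some_level ..
  then obtain n where n: "u (pt M n) \<noteq> 0" by blast
  have "- lam * \<bar>u (pt M n)\<bar> \<le> \<epsilon> m" if Mm: "M \<le> m" for m
  proof -
    obtain n' where n': "pt m n' = pt M n" using pt_mono_level[OF Mm] by blast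
    obtain p where p: "p \<in> vertices m" "\<And>n. \<bar>u (pt m n)\<bar> \<le> \<bar>u (fst p)\<bar>"
      "0 \<le> u (fst p) * - graph_laplacian m u p"
      using vertex_of_maximal_modulus[OF eigenfunction_graph_function[of m]] by blast
    let ?x = "u (fst p)"
    have x: "\<bar>u (pt M n)\<bar> \<le> \<bar>?x\<bar>" using p(2)[of n'] n' by simp
    have "- lam * \<bar>?x\<bar> * \<bar>?x\<bar> = - lam * (?x * ?x)" by (simp add: mult.assoc)
    also have "\<dots> \<le> 15 ^ m * (?x * - graph_laplacian m u p) - lam * (?x * ?x)"
      using mult_nonneg_nonneg[OF _ p(3), of "15 ^ m"] by simp
    also have "\<dots> = ?x * (15 ^ m * - graph_laplacian m u p - lam * ?x)" by algebra
    also have "\<dots> \<le> \<bar>?x\<bar> * \<bar>15 ^ m * - graph_laplacian m u p - lam * ?x\<bar>"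
      unfolding abs_mult[symmetric] by (rule abs_ge_self)
    also have "\<dots> \<le> \<bar>?x\<bar> * \<epsilon> m"
      using \<epsilon>(2)[rule_format, OF p(1)] by (intro mult_left_mono) auto
    finally have "- lam * \<bar>?x\<bar> * \<bar>?x\<bar> \<le> \<epsilon> m * \<bar>?x\<bar>" by (simp only: mult.commute)
    moreover have "0 < \<bar>?x\<bar>" using n x by linarith
    ultimately have "- lam * \<bar>?x\<bar> \<le> \<epsilon> m" by (rule mult_right_le_imp_le)
    moreover have "- lam * \<bar>u (pt M n)\<bar> \<le> - lam * \<bar>?x\<bar>" using x neg by (intro mult_left_mono) auto
    ultimately show ?thesis by linarith
  qed
  then have "- lam * \<bar>u (pt M n)\<bar> \<le> 0"
    by (intro LIMSEQ_le_const[OF \<epsilon>(1)]) blast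
  moreover have "0 < - lam * \<bar>u (pt M n)\<bar>" using neg n by (intro mult_pos_pos) auto
  ultimately show False by linarith
qed

text \<open>
  The number \<open>\<mu> k\<close> is obtained from the approximate eigenvalue \<open>lam / 15 ^ (m + k)\<close> of level \<open>m + k\<close> by
  decimating \<open>k\<close> times.  Its convergence need not be known in advance: since \<open>\<mu> k * u x\<close> converges to
  \<open>- \<Delta>\<^sub>m u x\<close> at every vertex \<open>x\<close>, it follows from a single vertex at which \<open>u\<close> is nonzero.
\<close>

lemma restriction_is_graph_eigenfunction:
  assumes small: "lam \<le> 15 ^ m" and nz: "\<exists>n. u (pt m n) \<noteq> 0"
  shows "\<exists>l. graph_eigenfunction m u l"
proof -
  obtain \<epsilon> where \<epsilon>: "\<epsilon> \<longlonglongrightarrow> 0" "\<forall>m. \<forall>p\<in>vertices m. \<bar>15 ^ m * - graph_laplacian m u p - lam * u (fst p)\<bar> \<le> \<epsilon> m"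
    using eigenfunction_residual_tendsto_0 by blast
  define \<mu> where "\<mu> k = (R ^^ k) (lam / 15 ^ (m + k))" for k
  have bound: "\<bar>residual m u (\<mu> k) p\<bar> \<le> \<epsilon> (m + k) / 15 ^ m" if p: "p \<in> vertices m" for p k
  proof -
    have "\<bar>residual m u (\<mu> k) p\<bar> \<le> 15 ^ k * (\<epsilon> (m + k) / 15 ^ (m + k))"
      unfolding \<mu>_def
    proof (rule residual_iterated_bound[OF eigenfunction_graph_function p])
      show "0 \<le> lam / 15 ^ (m + k)" using eigenvalue_nonneg by simp
      show "15 ^ k * (lam / 15 ^ (m + k)) \<le> 1" using small by (simp add: power_add field_simps)
      fix q assume q: "q \<in> vertices (m + k)"
      have "residual (m + k) u (lam / 15 ^ (m + k)) q
          = (15 ^ (m + k) * - graph_laplacian (m + k) u q - lam * u (fst q)) / 15 ^ (m + k)"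
        by (simp add: residual_def field_simps)
      then show "\<bar>residual (m + k) u (lam / 15 ^ (m + k)) q\<bar> \<le> \<epsilon> (m + k) / 15 ^ (m + k)"
        using \<epsilon>(2)[rule_format, OF q] by (simp add: abs_divide divide_right_mono)
    qed
    also have "\<dots> = \<epsilon> (m + k) / 15 ^ m" by (simp add: power_add)
    finally show ?thesis .
  qed
  have lim: "(\<lambda>k. \<mu> k * u (fst p)) \<longlonglongrightarrow> - graph_laplacian m u p" if p: "p \<in> vertices m" for p
  proof -
    have "(\<lambda>k. residual m u (\<mu> k) p) \<longlonglongrightarrow> 0"
    proof (rule tendsto_0_le[where K = 1])
      show "(\<lambda>k. \<epsilon> (m + k) / 15 ^ m) \<longlonglongrightarrow> 0"
        using LIMSEQ_ignore_initial_segment[OF \<epsilon>(1), of m]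
        by (intro tendsto_divide_zero) (simp add: add.commute)
      show "\<forall>\<^sub>F k in sequentially. norm (residual m u (\<mu> k) p) \<le> norm (\<epsilon> (m + k) / 15 ^ m) * 1"
        using order_trans[OF bound[OF p] abs_ge_self] by (intro always_eventually allI) simp
    qed
    from tendsto_diff[OF tendsto_const this, of "- graph_laplacian m u p"]
    show ?thesis by (simp add: residual_def)
  qed
  obtain p where p: "p \<in> vertices m" "u (fst p) \<noteq> 0"
    using nz graph_function_value_at_vertex[OF eigenfunction_graph_function[of m]] by metis
  define l where "l = - graph_laplacian m u p / u (fst p)"
  have "(\<lambda>k. \<mu> k * u (fst p) / u (fst p)) \<longlonglongrightarrow> l"
    unfolding l_def by (intro tendsto_divide lim p tendsto_const)
  then have \<mu>: "\<mu> \<longlonglongrightarrow> l" using p(2) by simp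
  have "- graph_laplacian m u q = l * u (fst q)" if "q \<in> vertices m" for q
    using LIMSEQ_unique[OF lim[OF that] tendsto_mult[OF \<mu> tendsto_const]] .
  then show ?thesis
    using nz eigenfunction_graph_function by (auto simp: graph_eigenfunction_def)
qed

text \<open>
  It suffices to read off the convergence of the Laplacians at one vertex where \<open>u\<close> is nonzero,
  because such a vertex belongs to all later levels.
\<close>

lemma scaled_graph_eigenvalues_tendsto:
  assumes l: "\<And>m. m\<^sub>0 \<le> m \<Longrightarrow> graph_eigenfunction m u (l m)"
  shows "(\<lambda>m. 15 ^ m * l m) \<longlonglongrightarrow> lam"
proof -
  obtain \<epsilon> where \<epsilon>: "\<epsilon> \<longlonglongrightarrow> 0" "\<forall>m. \<forall>p\<in>vertices m. \<bar>15 ^ m * - graph_laplacian m u p - lam * u (fst p)\<bar> \<le> \<epsilon> m"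
    using eigenfunction_residual_tendsto_0 by blast
  obtain n where "u (pt m\<^sub>0 n) \<noteq> 0" using l[of m\<^sub>0] by (auto simp: graph_eigenfunction_def)
  then obtain p where p: "p \<in> vertices m\<^sub>0" "u (fst p) \<noteq> 0"
    using graph_function_value_at_vertex[OF eigenfunction_graph_function[of m\<^sub>0], of n] by auto
  have "\<bar>15 ^ m * l m - lam\<bar> \<le> \<epsilon> m / \<bar>u (fst p)\<bar>" if "m\<^sub>0 \<le> m" for m
  proof -
    have pm: "p \<in> vertices m" using p(1) vertices_mono[OF that] by blast
    then have "- graph_laplacian m u p = l m * u (fst p)"
      using l[OF that] by (auto simp: graph_eigenfunction_def)
    with \<epsilon>(2)[rule_format, OF pm] have "\<bar>(15 ^ m * l m - lam) * u (fst p)\<bar> \<le> \<epsilon> m"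
      by (simp add: algebra_simps)
    then show ?thesis using p(2) by (simp only: abs_mult) (simp add: pos_le_divide_eq)
  qed
  then have "(\<lambda>m. 15 ^ m * l m - lam) \<longlonglongrightarrow> 0"
    by (intro tendsto_0_le[where K = 1, OF tendsto_divide_zero[OF \<epsilon>(1)], of _ "\<bar>u (fst p)\<bar>"])
       (auto simp: eventually_sequentially intro!: exI[of _ m\<^sub>0]
         intro: order_trans[OF _ divide_right_mono[OF abs_ge_self]])
  then show ?thesis by (rule LIM_zero_cancel)
qed

end

theorem theorem3p1:
  fixes u :: "real \<Rightarrow> real" and lam :: real
  assumes "vicsek_eigenfunction u lam"
  shows "\<exists>m\<^sub>0\<ge>1. \<exists>(l :: nat \<Rightarrow> real) (i :: nat \<Rightarrow> nat).
           (\<forall>m\<ge>m\<^sub>0. graph_eigenfunction m u (l m)) \<and>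
           (\<lambda>m. 15 ^ m * l m) \<longlonglongrightarrow> lam \<and>
           (\<forall>m\<ge>m\<^sub>0. i m \<in> {1, 2, 3} \<and> l (Suc m) = \<phi> (i m) (l m) \<and>
                     (l m = 0 \<longrightarrow> i m = 1 \<or> i m = 3)) \<and>
           (\<exists>m\<^sub>1\<ge>m\<^sub>0. \<forall>m\<ge>m\<^sub>1. i m = 1) \<and>
           (if m\<^sub>0 = 1 then l m\<^sub>0 \<in> {0, 1, 3, 5} else l m\<^sub>0 \<in> {1, 3})"
proof -
  define good where "good m \<longleftrightarrow> 1 \<le> m \<and> (\<forall>k\<ge>m. \<exists>l. graph_eigenfunction k u l)" for m
  obtain M where M: "\<And>m. M \<le> m \<Longrightarrow> \<exists>n. u (pt m n) \<noteq> 0"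
    using eigenfunction_nonzero_from_some_level[OF assms] by blast
  obtain N where N: "lam < 15 ^ N" using real_arch_pow[of 15 lam] by auto
  have "good (Suc (M + N))"
    unfolding good_def
  proof (intro conjI allI impI)
    fix k assume k: "Suc (M + N) \<le> k"
    then have "(15 :: real) ^ N \<le> 15 ^ k" by (intro power_increasing) auto
    then have "lam \<le> 15 ^ k" using N by linarith
    then show "\<exists>l. graph_eigenfunction k u l"
      using restriction_is_graph_eigenfunction[OF assms, of k] M[of k] k by auto
  qed simp
  define m0 where "m0 = (LEAST m. good m)"
  have good: "good m0" unfolding m0_def by (rule LeastI[of good, OF \<open>good (Suc (M + N))\<close>])
  then have "\<forall>k. \<exists>l. m0 \<le> k \<longrightarrow> graph_eigenfunction k u l" by (auto simp: good_def)
  then obtain l where l: "\<And>m. m0 \<le> m \<Longrightarrow> graph_eigenfunction m u (l m)" by metis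
  have lim: "(\<lambda>m. 15 ^ m * l m) \<longlonglongrightarrow> lam" by (rule scaled_graph_eigenvalues_tendsto[OF assms l])
  have dec: "l m = R (l (Suc m))" if "m0 \<le> m" for m
    using graph_eigenvalue_unique[OF l[OF that]] decimation_residual[OF l[of "Suc m"]] that by auto
  have bounds: "0 \<le> R (l (Suc m))" "R (l (Suc m)) \<le> 8" if "m0 \<le> m" for m
    using graph_eigenvalue_bounds[OF l[OF that]] dec[OF that] by auto
  have "\<exists>i\<in>{1, 2, 3}. l (Suc m) = \<phi> i (l m) \<and> (l (Suc m) < 1 \<longrightarrow> i = 1)" if "m0 \<le> m" for m
    using R_preimage_branch[OF bounds[OF that]] dec[OF that] by (cases "l (Suc m) < 1") auto
  then have "\<forall>m. \<exists>i. m0 \<le> m \<longrightarrow> i \<in> {1, 2, 3} \<and> l (Suc m) = \<phi> i (l m) \<and> (l (Suc m) < 1 \<longrightarrow> i = 1)" by blast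
  then obtain i where i: "\<And>m. m0 \<le> m \<Longrightarrow> i m \<in> {1, 2, 3} \<and> l (Suc m) = \<phi> (i m) (l m) \<and> (l (Suc m) < 1 \<longrightarrow> i m = 1)"
    by metis
  have ii: "i m = 1 \<or> i m = 3" if "m0 \<le> m" "l m = 0" for m
  proof (rule ccontr)
    assume "\<not> ?thesis"
    then have "i m = 2" using i[OF that(1)] by auto
    then have "l (Suc m) = 3" using i[OF that(1)] that(2) \<phi>_2_0 by simp
    then have "u (pt m n) = 0" for n
      using eigenvalue_3_vanishes_on_previous_level[of m u] l[of "Suc m"] that(1) by simp
    then show False using l[OF that(1)] by (auto simp: graph_eigenfunction_def)
  qed
  have "(\<lambda>m. (15 ^ m * l m) * (1 / 15) ^ m) \<longlonglongrightarrow> lam * 0"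
    by (intro tendsto_mult lim LIMSEQ_power_zero) simp
  then have "l \<longlonglongrightarrow> 0" by (simp add: power_one_over)
  then have "\<forall>\<^sub>F m in sequentially. l m < 1" by (rule order_tendstoD) simp
  then obtain m1 where m1: "\<And>m. m1 \<le> m \<Longrightarrow> l m < 1" by (auto simp: eventually_sequentially)
  have iii: "\<exists>m\<^sub>1\<ge>m0. \<forall>m\<ge>m\<^sub>1. i m = 1"
  proof (intro exI[of _ "max m0 m1"] conjI allI impI)
    fix m assume "max m0 m1 \<le> m"
    then show "i m = 1" using i[of m] m1[of "Suc m"] by simp
  qed simp
  \<comment> \<open>Minimality of \<open>m0\<close>: decimation can only fail to reach the level \<open>m0 - 1\<close> at the eigenvalues \<open>1\<close> and \<open>3\<close>.\<close>
  have iv: "if m0 = 1 then l m0 \<in> {0, 1, 3, 5} else l m0 \<in> {1, 3}"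
  proof (cases "l m0 \<in> {1, 3}")
    case False
    have "1 \<le> m0" using good by (simp add: good_def)
    then obtain m where m: "m0 = Suc m" by (cases m0) auto
    have eig: "graph_eigenfunction m u (R (l m0))"
      using eigenfunction_decimation[of m u "l m0"] l[of m0] False m by auto
    have "m = 0"
    proof (rule ccontr)
      assume "m \<noteq> 0"
      have "\<exists>l. graph_eigenfunction k u l" if "m \<le> k" for k
        using eig l[of k] that m by (cases "k = m") auto
      with \<open>m \<noteq> 0\<close> have "good m" by (simp add: good_def)
      then show False using not_less_Least[of m good] m unfolding m0_def by simp
    qed
    then have "R (l m0) = 0" using level_0_eigenvalue eig by blast
    then show ?thesis using \<open>m = 0\<close> m by (auto simp: R_def)
  qed auto
  have ivals: "\<forall>m\<ge>m0. i m \<in> {1, 2, 3} \<and> l (Suc m) = \<phi> (i m) (l m) \<and> (l m = 0 \<longrightarrow> i m = 1 \<or> i m = 3)"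
    using i ii by blast
  have "1 \<le> m0" "\<forall>m\<ge>m0. graph_eigenfunction m u (l m)" using good l by (auto simp: good_def)
  with lim ivals iii iv show ?thesis by blast
qed

end
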